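(* Let $A$ be a (bounded) distributive lattice, let $j\colon A\hookrightarrow A^\delta$ be its (distributive lattice) canonical extension, and let $e\colon \mathrm{Idl}(A)\to \mathrm{Idl}(A)^\delta$ be the (frame) canonical extension of the frame $\mathrm{Idl}(A)$. Then $A^\delta$ is isomorphic to $\mathrm{Idl}(A)^\delta$, as an extension of $A$; that is, there is an isomorphism of complete lattices $\varphi\colon A^\delta\to\mathrm{Idl}(A)^\delta$ with $\varphi(j(a))=e(\downarrow a)$ for all $a\in A$.
   Context: All lattices are bounded. $\mathrm{Idl}(A)$ is the frame of ideals of $A$ (downsets closed under finite joins, so containing $0$; improper ideal allowed), ordered by inclusion; filters are defined dually. $\downarrow a=\{b\in A\mid b\le a\}$. Canonical extension of a distributive lattice $A$: a lattice embedding $j\colon A\hookrightarrow A^\delta$ into a complete lattice such that (Dense) for all $u,v\in A^\delta$: $u\le v$ holds provided that for every filter $F\subseteq A$ and ideal $I\subseteq A$, $\bigwedge j[F]\le u$ and $v\le\bigvee j[I]$ imply $\bigwedge j[F]\le\bigvee j[I]$; (Compact) if $\bigwedge j[F]\le\bigvee j[I]$ for a filter $F\subseteq A$ and an ideal $I\subseteq A$, then $F\cap I\ne\emptyset$. It exists and is unique up to isomorphism over $A$. Canonical extension of a frame $L$ (a complete lattice in which finite meets distribute over arbitrary joins): let $L^{\wedge}$ be the set of Scott-open filters of $L$, i.e. upsets $\kappa$ closed under finite meets (improper filter allowed) such that whenever $D\subseteq L$ is directed with $\bigvee D\in\kappa$, some $d\in D$ lies in $\kappa$. A canonical extension of $L$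 is a monotone map $e\colon L\to L^\delta$ into a complete lattice such that (Dense) for all $u,v\in L^\delta$: $u\le v$ holds provided that for all $\kappa\in L^{\wedge}$ and $a\in L$, $\bigwedge e[\kappa]\le u$ and $v\le e(a)$ together imply $\bigwedge e[\kappa]\le e(a)$; (Compact) if $\bigwedge e[\kappa]\le e(a)$ for some $\kappa\in L^{\wedge}$ and $a\in L$, then $a\in\kappa$. It exists and is unique up to isomorphism. *)

theory Defs
  imports Main
begin

definition lattice_ideal :: "'a::bounded_lattice set \<Rightarrow> bool" where
  "lattice_ideal I \<longleftrightarrow>
     (\<forall>x\<in>I. \<forall>y. y \<le> x \<longrightarrow> y \<in> I) \<and> bot \<in> I \<and> (\<forall>x\<in>I. \<forall>y\<in>I. sup x y \<in> I)"

definition lattice_filter :: "'a::bounded_lattice set \<Rightarrow> bool" where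
  "lattice_filter F \<longleftrightarrow>
     (\<forall>x\<in>F. \<forall>y. x \<le> y \<longrightarrow> y \<in> F) \<and> top \<in> F \<and> (\<forall>x\<in>F. \<forall>y\<in>F. inf x y \<in> F)"

class frame = complete_lattice +
  assumes inf_Sup_frame: "inf a (Sup B) = (SUP b\<in>B. inf a b)"

typedef (overloaded) 'a idl = "{I :: 'a::bounded_lattice set. lattice_ideal I}"
  morphisms idl_set Abs_idl
proof
  show "UNIV \<in> {I :: 'a set. lattice_ideal I}" by (simp add: lattice_ideal_def)
qed

lemma lattice_ideal_idl_set [simp]: "lattice_ideal (idl_set I)"
  using idl_set by blast

lemma idl_set_Abs_idl: "lattice_ideal I \<Longrightarrow> idl_set (Abs_idl I) = I"
  by (simp add: Abs_idl_inverse)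

lemma lattice_ideal_Inter: "(\<And>I. I \<in> \<I> \<Longrightarrow> lattice_ideal I) \<Longrightarrow> lattice_ideal (\<Inter>\<I>)"
  unfolding lattice_ideal_def by blast

definition ideal_generated :: "'a::bounded_lattice set \<Rightarrow> 'a set" where
  "ideal_generated X = \<Inter>{I. lattice_ideal I \<and> X \<subseteq> I}"

lemma lattice_ideal_generated [simp]: "lattice_ideal (ideal_generated X)"
  unfolding ideal_generated_def by (rule lattice_ideal_Inter) simp

lemma subset_ideal_generated: "X \<subseteq> ideal_generated X"
  unfolding ideal_generated_def by blast

lemma ideal_generated_least: "lattice_ideal I \<Longrightarrow> X \<subseteq> I \<Longrightarrow> ideal_generated X \<subseteq> I"
  unfolding ideal_generated_def by blast

instantiation idl :: (bounded_lattice) complete_lattice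
begin

definition less_eq_idl :: "'a idl \<Rightarrow> 'a idl \<Rightarrow> bool" where
  "I \<le> J \<longleftrightarrow> idl_set I \<subseteq> idl_set J"

definition less_idl :: "'a idl \<Rightarrow> 'a idl \<Rightarrow> bool" where
  "I < J \<longleftrightarrow> idl_set I \<subset> idl_set J"

definition Inf_idl :: "'a idl set \<Rightarrow> 'a idl" where
  "Inf \<I> = Abs_idl (\<Inter>(idl_set ` \<I>))"

definition Sup_idl :: "'a idl set \<Rightarrow> 'a idl" where
  "Sup \<I> = Abs_idl (ideal_generated (\<Union>(idl_set ` \<I>)))"

definition inf_idl :: "'a idl \<Rightarrow> 'a idl \<Rightarrow> 'a idl" where
  "inf I J = Abs_idl (idl_set I \<inter> idl_set J)"

definition sup_idl :: "'a idl \<Rightarrow> 'a idl \<Rightarrow> 'a idl" where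
  "sup I J = Abs_idl (ideal_generated (idl_set I \<union> idl_set J))"

definition bot_idl :: "'a idl" where
  "bot = Abs_idl {bot}"

definition top_idl :: "'a idl" where
  "top = Abs_idl UNIV"

lemma idl_set_Inf: "idl_set (Inf \<I>) = \<Inter>(idl_set ` \<I>)" for \<I> :: "'a idl set"
  unfolding Inf_idl_def by (rule idl_set_Abs_idl, rule lattice_ideal_Inter) auto

lemma idl_set_Sup: "idl_set (Sup \<I>) = ideal_generated (\<Union>(idl_set ` \<I>))" for \<I> :: "'a idl set"
  unfolding Sup_idl_def by (rule idl_set_Abs_idl) simp

lemma idl_set_inf: "idl_set (inf I J) = idl_set I \<inter> idl_set J" for I J :: "'a idl"
proof -
  have "lattice_ideal (\<Inter>{idl_set I, idl_set J})" by (rule lattice_ideal_Inter) auto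
  then show ?thesis by (simp add: inf_idl_def idl_set_Abs_idl)
qed

lemma idl_set_sup: "idl_set (sup I J) = ideal_generated (idl_set I \<union> idl_set J)" for I J :: "'a idl"
  unfolding sup_idl_def by (rule idl_set_Abs_idl) simp

lemma idl_set_bot: "idl_set (bot :: 'a idl) = {bot}"
  unfolding bot_idl_def by (rule idl_set_Abs_idl) (auto simp: lattice_ideal_def bot_unique)

lemma idl_set_top: "idl_set (top :: 'a idl) = UNIV"
  unfolding top_idl_def by (rule idl_set_Abs_idl) (auto simp: lattice_ideal_def)

instance
proof
  fix I J K :: "'a idl" and \<I> :: "'a idl set"
  show "I < J \<longleftrightarrow> I \<le> J \<and> \<not> J \<le> I" by (auto simp: less_eq_idl_def less_idl_def)
  show "I \<le> I" by (simp add: less_eq_idl_def)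
  show "I \<le> J \<Longrightarrow> J \<le> K \<Longrightarrow> I \<le> K" by (simp add: less_eq_idl_def)
  show "I \<le> J \<Longrightarrow> J \<le> I \<Longrightarrow> I = J" by (simp add: less_eq_idl_def idl_set_inject[symmetric])
  show "inf I J \<le> I" "inf I J \<le> J" by (simp_all add: less_eq_idl_def idl_set_inf)
  show "I \<le> J \<Longrightarrow> I \<le> K \<Longrightarrow> I \<le> inf J K" by (simp add: less_eq_idl_def idl_set_inf)
  show "I \<le> sup I J" "J \<le> sup I J"
    using subset_ideal_generated[of "idl_set I \<union> idl_set J"]
    by (simp_all add: less_eq_idl_def idl_set_sup)
  show "J \<le> I \<Longrightarrow> K \<le> I \<Longrightarrow> sup J K \<le> I"
    by (simp add: less_eq_idl_def idl_set_sup ideal_generated_least)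
  show "I \<in> \<I> \<Longrightarrow> Inf \<I> \<le> I" by (auto simp: less_eq_idl_def idl_set_Inf)
  show "(\<And>J. J \<in> \<I> \<Longrightarrow> I \<le> J) \<Longrightarrow> I \<le> Inf \<I>" by (auto simp: less_eq_idl_def idl_set_Inf)
  show "I \<in> \<I> \<Longrightarrow> I \<le> Sup \<I>"
    using subset_ideal_generated[of "\<Union>(idl_set ` \<I>)"] by (auto simp: less_eq_idl_def idl_set_Sup)
  show "(\<And>J. J \<in> \<I> \<Longrightarrow> J \<le> I) \<Longrightarrow> Sup \<I> \<le> I"
    unfolding less_eq_idl_def idl_set_Sup by (rule ideal_generated_least) auto
  show "Inf {} = (top :: 'a idl)" by (simp add: idl_set_inject[symmetric] idl_set_Inf idl_set_top)
  have "ideal_generated {} = {bot :: 'a}"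
  proof
    show "ideal_generated {} \<subseteq> {bot :: 'a}"
      by (rule ideal_generated_least) (auto simp: lattice_ideal_def bot_unique)
    show "{bot :: 'a} \<subseteq> ideal_generated {}"
      using lattice_ideal_generated[of "{} :: 'a set"] by (auto simp: lattice_ideal_def)
  qed
  then show "Sup {} = (bot :: 'a idl)"
    by (simp add: idl_set_inject[symmetric] idl_set_Sup idl_set_bot)
qed

end

instance idl :: ("{distrib_lattice, bounded_lattice}") frame
proof
  fix I :: "'a idl" and \<J> :: "'a idl set"
  let ?G = "idl_set (SUP J\<in>\<J>. inf I J)"
  let ?K = "{x. \<forall>y\<in>idl_set I. inf x y \<in> ?G}"
  have G: "lattice_ideal ?G" by simp
  have "lattice_ideal ?K"
    unfolding lattice_ideal_def
  proof (intro conjI ballI allI impI)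
    fix x y assume "x \<in> ?K" and "y \<le> x"
    then show "y \<in> ?K" using G unfolding lattice_ideal_def by (blast intro: inf_mono)
  next
    show "bot \<in> ?K" using G by (simp add: lattice_ideal_def)
  next
    fix x y assume "x \<in> ?K" and "y \<in> ?K"
    then show "sup x y \<in> ?K" using G by (simp add: lattice_ideal_def inf_sup_distrib2)
  qed
  moreover have "idl_set J \<subseteq> ?K" if "J \<in> \<J>" for J
  proof
    fix x assume x: "x \<in> idl_set J"
    have "inf x y \<in> ?G" if y: "y \<in> idl_set I" for y
    proof -
      have "inf x y \<in> idl_set (inf I J)"
        using x y lattice_ideal_idl_set[of I] lattice_ideal_idl_set[of J]
        unfolding idl_set_inf lattice_ideal_def by (meson IntI inf_le1 inf_le2)
      moreover have "inf I J \<le> (SUP J\<in>\<J>. inf I J)" using \<open>J \<in> \<J>\<close> by (rule SUP_upper)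
      ultimately show ?thesis by (auto simp: less_eq_idl_def)
    qed
    then show "x \<in> ?K" by simp
  qed
  ultimately have "idl_set (Sup \<J>) \<subseteq> ?K"
    unfolding idl_set_Sup[of \<J>] by (intro ideal_generated_least) auto
  then have "inf I (Sup \<J>) \<le> (SUP J\<in>\<J>. inf I J)"
    unfolding less_eq_idl_def idl_set_inf by (auto dest!: subsetD)
  moreover have "(SUP J\<in>\<J>. inf I J) \<le> inf I (Sup \<J>)"
    by (rule SUP_least) (meson Sup_upper inf_mono order_refl)
  ultimately show "inf I (Sup \<J>) = (SUP J\<in>\<J>. inf I J)" by (rule antisym)
qed

definition principal_idl :: "'a::bounded_lattice \<Rightarrow> 'a idl" where
  "principal_idl a = Abs_idl {b. b \<le> a}"

lemma idl_set_principal_idl [simp]: "idl_set (principal_idl a) = {b. b \<le> a}"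
  unfolding principal_idl_def
  by (rule idl_set_Abs_idl) (auto simp: lattice_ideal_def intro: order_trans)

definition bounded_lattice_embedding :: "('a::bounded_lattice \<Rightarrow> 'b::bounded_lattice) \<Rightarrow> bool" where
  "bounded_lattice_embedding j \<longleftrightarrow>
     inj j \<and> j bot = bot \<and> j top = top \<and>
     (\<forall>x y. j (inf x y) = inf (j x) (j y)) \<and> (\<forall>x y. j (sup x y) = sup (j x) (j y))"

definition lattice_canonical_extension ::
    "('a::{distrib_lattice, bounded_lattice} \<Rightarrow> 'b::complete_lattice) \<Rightarrow> bool" where
  "lattice_canonical_extension j \<longleftrightarrow>
     bounded_lattice_embedding j \<and>
     (\<forall>u v. (\<forall>F I. lattice_filter F \<longrightarrow> lattice_ideal I \<longrightarrow>
                Inf (j ` F) \<le> u \<longrightarrow> v \<le> Sup (j ` I) \<longrightarrow> Inf (j ` F) \<le> Sup (j ` I))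
            \<longrightarrow> u \<le> v) \<and>
     (\<forall>F I. lattice_filter F \<longrightarrow> lattice_ideal I \<longrightarrow>
                Inf (j ` F) \<le> Sup (j ` I) \<longrightarrow> F \<inter> I \<noteq> {})"

text \<open>Directed sets are nonempty; otherwise the improper filter would not be Scott-open.\<close>

definition directed_set :: "'a::order set \<Rightarrow> bool" where
  "directed_set D \<longleftrightarrow> D \<noteq> {} \<and> (\<forall>x\<in>D. \<forall>y\<in>D. \<exists>z\<in>D. x \<le> z \<and> y \<le> z)"

definition scott_open_filter :: "'l::complete_lattice set \<Rightarrow> bool" where
  "scott_open_filter \<kappa> \<longleftrightarrow>
     lattice_filter \<kappa> \<and> (\<forall>D. directed_set D \<longrightarrow> Sup D \<in> \<kappa> \<longrightarrow> (\<exists>d\<in>D. d \<in> \<kappa>))"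

definition frame_canonical_extension :: "('l::frame \<Rightarrow> 'm::complete_lattice) \<Rightarrow> bool" where
  "frame_canonical_extension e \<longleftrightarrow>
     mono e \<and>
     (\<forall>u v. (\<forall>\<kappa> a. scott_open_filter \<kappa> \<longrightarrow>
                Inf (e ` \<kappa>) \<le> u \<longrightarrow> v \<le> e a \<longrightarrow> Inf (e ` \<kappa>) \<le> e a)
            \<longrightarrow> u \<le> v) \<and>
     (\<forall>\<kappa> a. scott_open_filter \<kappa> \<longrightarrow> Inf (e ` \<kappa>) \<le> e a \<longrightarrow> a \<in> \<kappa>)"

definition complete_lattice_iso :: "('b::complete_lattice \<Rightarrow> 'c::complete_lattice) \<Rightarrow> bool" where
  "complete_lattice_iso \<phi> \<longleftrightarrow>
     bij \<phi> \<and> (\<forall>S. \<phi> (Sup S) = Sup (\<phi> ` S)) \<and> (\<forall>S. \<phi> (Inf S) = Inf (\<phi> ` S))"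

end

(* Both completions are generated by a family of "closed" elements (meets of filters) and a family
   of "open" elements (joins of ideals, resp. values of the extension map), and density makes
   a completion depend only on the relation "closed element below open element".
   Sending a filter F of A to the set of ideals meeting F is a bijection from the filters of A to
   the Scott-open filters of Idl(A), and by compactness the relation is in both cases
   "F meets I". Hence the two completions agree. *)

theory Submission
  imports Defs
begin

section \<open>Completions determined by a relation between closed and open elements\<close>

text \<open>The common shape of both density conditions: \<open>p\<close> gives the closed elements,
  \<open>q\<close> the open ones. The set \<open>X\<close> cuts the filters out of a type of sets,
  whereas ideals form the type \<open>idl\<close> and need no such restriction.\<close>

definition dense_pair :: "'x set \<Rightarrow> ('x \<Rightarrow> 'b::complete_lattice) \<Rightarrow> ('y \<Rightarrow> 'b) \<Rightarrow> bool" where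
  "dense_pair X p q \<longleftrightarrow>
     (\<forall>u v. (\<forall>x\<in>X. \<forall>y. p x \<le> u \<longrightarrow> v \<le> q y \<longrightarrow> p x \<le> q y) \<longrightarrow> u \<le> v)"

lemma dense_pair_leI:
  assumes "dense_pair X p q" and "\<And>x y. x \<in> X \<Longrightarrow> p x \<le> u \<Longrightarrow> v \<le> q y \<Longrightarrow> p x \<le> q y"
  shows "u \<le> v"
  using assms unfolding dense_pair_def by blast

text \<open>If \<open>p x \<le> v\<close> and \<open>v \<le> q y\<close>, then
  \<open>p x \<le> q y\<close> by transitivity. Thus closed elements are join-dense; dually, the
  next lemma makes open elements meet-dense.\<close>

lemma dense_pair_le_closed:
  assumes "dense_pair X p q" and "\<And>x. x \<in> X \<Longrightarrow> p x \<le> u \<Longrightarrow> p x \<le> v"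
  shows "u \<le> v"
  by (rule dense_pair_leI[OF assms(1)]) (meson assms(2) order_trans)

lemma dense_pair_le_open:
  assumes "dense_pair X p q" and "\<And>y. v \<le> q y \<Longrightarrow> u \<le> q y"
  shows "u \<le> v"
  by (rule dense_pair_leI[OF assms(1)]) (meson assms(2) order_trans)

text \<open>The candidate isomorphism: join-density forces the image of \<open>u\<close> to be the
  join of the images of the closed elements below \<open>u\<close>.\<close>

definition closed_transfer ::
    "'x set \<Rightarrow> ('x \<Rightarrow> 'b::complete_lattice) \<Rightarrow> ('x \<Rightarrow> 'c::complete_lattice) \<Rightarrow> 'b \<Rightarrow> 'c" where
  "closed_transfer X p p' u = (SUP x\<in>{x \<in> X. p x \<le> u}. p' x)"

text \<open>An open \<open>q y\<close> above \<open>u\<close> lies above every closed element below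
  \<open>u\<close>, so by the shared relation \<open>q' y\<close> bounds the join defining the
  transfer. Hence \<open>p' x\<close> below the transfer yields \<open>p x \<le> q y\<close> for all
  such \<open>y\<close>, and meet-density of the open elements applies.\<close>

lemma closed_le_transfer_iff:
  assumes "dense_pair X p q" and "\<And>x y. x \<in> X \<Longrightarrow> p x \<le> q y \<longleftrightarrow> p' x \<le> q' y" and "x \<in> X"
  shows "p' x \<le> closed_transfer X p p' u \<longleftrightarrow> p x \<le> u"
proof
  assume le: "p' x \<le> closed_transfer X p p' u"
  show "p x \<le> u"
  proof (rule dense_pair_le_open[OF assms(1)])
    fix y assume "u \<le> q y"
    then have "closed_transfer X p p' u \<le> q' y"
      unfolding closed_transfer_def
      by (intro SUP_least) (auto simp flip: assms(2) intro: order_trans)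
    then show "p x \<le> q y"
      using le assms(2,3) by (blast intro: order_trans)
  qed
next
  assume "p x \<le> u"
  then show "p' x \<le> closed_transfer X p p' u"
    unfolding closed_transfer_def using assms(3) by (intro SUP_upper) simp
qed

text \<open>Transferring back takes the join over the very same indices, namely those with
  \<open>p x \<le> u\<close>, and join-density recovers \<open>u\<close>.\<close>

lemma closed_transfer_inverse:
  assumes "dense_pair X p q" and "\<And>x y. x \<in> X \<Longrightarrow> p x \<le> q y \<longleftrightarrow> p' x \<le> q' y"
  shows "closed_transfer X p' p (closed_transfer X p p' u) = u"
proof (rule antisym)
  have "{x \<in> X. p' x \<le> closed_transfer X p p' u} = {x \<in> X. p x \<le> u}"
    using closed_le_transfer_iff[OF assms] by blast
  then have "closed_transfer X p' p (closed_transfer X p p' u) = (SUP x\<in>{x \<in> X. p x \<le> u}. p x)"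
    by (simp add: closed_transfer_def[of X p' p])
  moreover have "u \<le> (SUP x\<in>{x \<in> X. p x \<le> u}. p x)"
    by (rule dense_pair_le_closed[OF assms(1)]) (auto intro: SUP_upper)
  moreover have "(SUP x\<in>{x \<in> X. p x \<le> u}. p x) \<le> u"
    by (rule SUP_least) simp
  ultimately show "closed_transfer X p' p (closed_transfer X p p' u) \<le> u"
    and "u \<le> closed_transfer X p' p (closed_transfer X p p' u)"
    by simp_all
qed

lemma complete_lattice_isoI:
  fixes f :: "'b::complete_lattice \<Rightarrow> 'c::complete_lattice"
  assumes mono: "mono f" "mono g" and inv: "\<And>x. g (f x) = x" "\<And>y. f (g y) = y"
  shows "complete_lattice_iso f"
  unfolding complete_lattice_iso_def
proof (intro conjI allI)
  show "bij f"
    using inv by (metis bijI')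
next
  fix S
  have "g (f x) \<le> g (Sup (f ` S))" "g (Inf (f ` S)) \<le> g (f x)" if "x \<in> S" for x
    using that by (auto intro!: monoD[OF mono(2)] Sup_upper Inf_lower)
  then have "Sup S \<le> g (Sup (f ` S))" "g (Inf (f ` S)) \<le> Inf S"
    by (auto simp: inv intro!: Sup_least Inf_greatest)
  \<comment> \<open>Apply \<open>f\<close> to the bounds obtained on the \<open>g\<close> side; the
    opposite inequalities hold for any monotone map.\<close>
  then have "f (Sup S) \<le> Sup (f ` S)" "Inf (f ` S) \<le> f (Inf S)"
    by (metis monoD[OF mono(1)] inv(2))+
  then show "f (Sup S) = Sup (f ` S)" "f (Inf S) = Inf (f ` S)"
    using mono_Sup[OF mono(1), of S] mono_Inf[OF mono(1), of S] by (auto intro: antisym)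
qed

lemma mono_closed_transfer: "mono (closed_transfer X p p')"
  unfolding closed_transfer_def
  by (rule monoI, rule SUP_subset_mono) (auto intro: order_trans)

lemma dense_pair_iso:
  fixes p :: "'x \<Rightarrow> 'b::complete_lattice" and p' :: "'x \<Rightarrow> 'c::complete_lattice"
  assumes dense: "dense_pair X p q" "dense_pair X p' q'"
    and rel: "\<And>x y. x \<in> X \<Longrightarrow> p x \<le> q y \<longleftrightarrow> p' x \<le> q' y"
  shows "\<exists>\<phi>. complete_lattice_iso \<phi> \<and> (\<forall>y. \<phi> (q y) = q' y)"
proof (intro exI conjI allI)
  show "complete_lattice_iso (closed_transfer X p p')"
    using mono_closed_transfer mono_closed_transfer
      closed_transfer_inverse[OF dense(1) rel] closed_transfer_inverse[OF dense(2) rel[symmetric]]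
    by (rule complete_lattice_isoI)
  fix y
  \<comment> \<open>The transfer of \<open>q y\<close> and the element \<open>q' y\<close> have the
    same closed elements below them, so join-density in the target identifies them.\<close>
  have "p' x \<le> closed_transfer X p p' (q y) \<longleftrightarrow> p' x \<le> q' y" if "x \<in> X" for x
    using closed_le_transfer_iff[OF dense(1) rel that] rel[OF that] by simp
  then show "closed_transfer X p p' (q y) = q' y"
    by - (rule antisym; rule dense_pair_le_closed[OF dense(2)]; simp)
qed

section \<open>Scott-open filters of the frame of ideals\<close>

text \<open>Equivalently, the upset of the ideal frame generated by the principal ideals of elements
  of \<open>F\<close>.\<close>

definition ideals_meeting :: "'a::bounded_lattice set \<Rightarrow> 'a idl set" where
  "ideals_meeting F = {I. F \<inter> idl_set I \<noteq> {}}"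

lemma principal_idl_le_iff: "principal_idl a \<le> I \<longleftrightarrow> a \<in> idl_set I"
  using lattice_ideal_idl_set[of I] unfolding less_eq_idl_def lattice_ideal_def by auto

lemma principal_idl_mono: "a \<le> b \<Longrightarrow> principal_idl a \<le> principal_idl b"
  by (simp add: principal_idl_le_iff)

lemma principal_idl_inf: "principal_idl (inf a b) = inf (principal_idl a) (principal_idl b)"
  by (auto simp: idl_set_inject[symmetric] idl_set_inf)

lemma principal_idl_top: "principal_idl top = top"
  by (simp add: idl_set_inject[symmetric] idl_set_top)

lemma Sup_principal_idl: "(SUP a\<in>idl_set I. principal_idl a) = I"
proof (rule antisym)
  show "(SUP a\<in>idl_set I. principal_idl a) \<le> I"
    by (rule SUP_least) (simp add: principal_idl_le_iff)
  have "a \<in> idl_set (SUP a\<in>idl_set I. principal_idl a)" if "a \<in> idl_set I" for a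
    using that by (subst principal_idl_le_iff[symmetric]) (rule SUP_upper)
  then show "I \<le> (SUP a\<in>idl_set I. principal_idl a)"
    by (auto simp: less_eq_idl_def)
qed

text \<open>Together with \<open>Sup_principal_idl\<close> this presents each ideal as a directed
  join of principal ideals, ready for use with Scott-openness.\<close>

lemma directed_principal_idl: "directed_set (principal_idl ` idl_set I)"
  unfolding directed_set_def
proof (intro conjI ballI)
  have "bot \<in> idl_set I"
    using lattice_ideal_idl_set[of I] unfolding lattice_ideal_def by simp
  then show "principal_idl ` idl_set I \<noteq> {}"
    by blast
next
  fix J K assume "J \<in> principal_idl ` idl_set I" "K \<in> principal_idl ` idl_set I"
  then obtain a b where "J = principal_idl a" "K = principal_idl b"
    and "a \<in> idl_set I" "b \<in> idl_set I" by blast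
  moreover from \<open>a \<in> idl_set I\<close> \<open>b \<in> idl_set I\<close> have "sup a b \<in> idl_set I"
    using lattice_ideal_idl_set[of I] unfolding lattice_ideal_def by simp
  ultimately show "\<exists>z\<in>principal_idl ` idl_set I. J \<le> z \<and> K \<le> z"
    by (blast intro: principal_idl_mono sup_ge1 sup_ge2)
qed

text \<open>The union is already an ideal: elements of two members lie in a common larger member,
  which contains their join.\<close>

lemma idl_set_Sup_directed:
  assumes "directed_set D"
  shows "idl_set (Sup D) = \<Union>(idl_set ` D)"
proof
  have "lattice_ideal (\<Union>(idl_set ` D))"
    unfolding lattice_ideal_def
  proof (intro conjI ballI allI impI)
    fix x y assume "x \<in> \<Union>(idl_set ` D)" "y \<le> x"
    then obtain I where "I \<in> D" "x \<in> idl_set I" by blast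
    moreover from \<open>x \<in> idl_set I\<close> \<open>y \<le> x\<close> have "y \<in> idl_set I"
      using lattice_ideal_idl_set[of I] unfolding lattice_ideal_def by blast
    ultimately show "y \<in> \<Union>(idl_set ` D)" by blast
  next
    \<comment> \<open>Nonemptiness of \<open>D\<close> is what puts \<open>bot\<close> into the
      union.\<close>
    from assms obtain I where "I \<in> D" unfolding directed_set_def by blast
    moreover have "bot \<in> idl_set I"
      using lattice_ideal_idl_set[of I] unfolding lattice_ideal_def by simp
    ultimately show "bot \<in> \<Union>(idl_set ` D)" by blast
  next
    fix x y assume "x \<in> \<Union>(idl_set ` D)" "y \<in> \<Union>(idl_set ` D)"
    then obtain I J where "I \<in> D" "J \<in> D" "x \<in> idl_set I" "y \<in> idl_set J" by blast
    moreover from this obtain K where "K \<in> D" "I \<le> K" "J \<le> K"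
      using assms unfolding directed_set_def by blast
    ultimately have "x \<in> idl_set K" "y \<in> idl_set K"
      by (auto simp: less_eq_idl_def)
    then have "sup x y \<in> idl_set K"
      using lattice_ideal_idl_set[of K] unfolding lattice_ideal_def by blast
    with \<open>K \<in> D\<close> show "sup x y \<in> \<Union>(idl_set ` D)" by blast
  qed
  then show "idl_set (Sup D) \<subseteq> \<Union>(idl_set ` D)"
    unfolding idl_set_Sup by (rule ideal_generated_least) simp
  show "\<Union>(idl_set ` D) \<subseteq> idl_set (Sup D)"
    unfolding idl_set_Sup by (rule subset_ideal_generated)
qed

text \<open>The meet of two witnesses lies in \<open>F\<close> and in both ideals, and a witness in
  a directed join, being a union, lies in some member.\<close>

lemma scott_open_ideals_meeting:
  assumes F: "lattice_filter F"
  shows "scott_open_filter (ideals_meeting F)"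
  unfolding scott_open_filter_def
proof (intro conjI allI impI)
  show "lattice_filter (ideals_meeting F)"
    unfolding lattice_filter_def
  proof (intro conjI ballI allI impI)
    fix I J :: "'a idl" assume "I \<in> ideals_meeting F" "I \<le> J"
    then show "J \<in> ideals_meeting F"
      unfolding ideals_meeting_def less_eq_idl_def by blast
  next
    show "top \<in> ideals_meeting F"
      using F unfolding lattice_filter_def ideals_meeting_def by (auto simp: idl_set_top)
  next
    fix I J :: "'a idl" assume "I \<in> ideals_meeting F" "J \<in> ideals_meeting F"
    then obtain a b where "a \<in> F" "b \<in> F" "a \<in> idl_set I" "b \<in> idl_set J"
      unfolding ideals_meeting_def by blast
    moreover from this have "inf a b \<in> idl_set I" "inf a b \<in> idl_set J"
      using lattice_ideal_idl_set[of I] lattice_ideal_idl_set[of J]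
      unfolding lattice_ideal_def by (meson inf_le1 inf_le2)+
    moreover from \<open>a \<in> F\<close> \<open>b \<in> F\<close> have "inf a b \<in> F"
      using F unfolding lattice_filter_def by simp
    ultimately show "inf I J \<in> ideals_meeting F"
      by (auto simp: ideals_meeting_def idl_set_inf)
  qed
next
  fix D :: "'a idl set" assume "directed_set D" "Sup D \<in> ideals_meeting F"
  then show "\<exists>d\<in>D. d \<in> ideals_meeting F"
    unfolding ideals_meeting_def by (auto simp: idl_set_Sup_directed)
qed

text \<open>The filter is the trace of \<kappa> on principal ideals. Scott-openness finds a
  principal ideal in \<kappa> below each member of \<kappa>; upward closure gives the
  converse.\<close>

lemma scott_open_filter_is_ideals_meeting:
  assumes "scott_open_filter \<kappa>"
  shows "\<exists>F. lattice_filter F \<and> \<kappa> = ideals_meeting F"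
proof (intro exI conjI)
  let ?F = "{a. principal_idl a \<in> \<kappa>}"
  have filter: "lattice_filter \<kappa>"
    using assms unfolding scott_open_filter_def by simp
  show "lattice_filter ?F"
    unfolding lattice_filter_def
  proof (intro conjI ballI allI impI)
    fix a b assume "a \<in> ?F" "a \<le> b"
    then show "b \<in> ?F"
      using filter principal_idl_mono[OF \<open>a \<le> b\<close>] unfolding lattice_filter_def by blast
  qed (use filter in \<open>simp_all add: lattice_filter_def principal_idl_inf principal_idl_top\<close>)
  show "\<kappa> = ideals_meeting ?F"
  proof (intro set_eqI iffI)
    fix I assume "I \<in> \<kappa>"
    then have "Sup (principal_idl ` idl_set I) \<in> \<kappa>"
      by (simp add: Sup_principal_idl)
    then show "I \<in> ideals_meeting ?F"
      using assms directed_principal_idl[of I]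
      unfolding scott_open_filter_def ideals_meeting_def by blast
  next
    fix I assume "I \<in> ideals_meeting ?F"
    then obtain a where "principal_idl a \<in> \<kappa>" "principal_idl a \<le> I"
      unfolding ideals_meeting_def principal_idl_le_iff by blast
    then show "I \<in> \<kappa>"
      using filter unfolding lattice_filter_def by blast
  qed
qed

section \<open>Comparison of the two canonical extensions\<close>

lemma lattice_extension_dense_pair:
  assumes "lattice_canonical_extension j"
  shows "dense_pair {F. lattice_filter F} (\<lambda>F. Inf (j ` F)) (\<lambda>I. Sup (j ` idl_set I))"
  unfolding dense_pair_def
proof (intro allI impI)
  fix u v
  assume H: "\<forall>F\<in>{F. lattice_filter F}. \<forall>I. Inf (j ` F) \<le> u \<longrightarrow> v \<le> Sup (j ` idl_set I) \<longrightarrow>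
      Inf (j ` F) \<le> Sup (j ` idl_set I)"
  have "Inf (j ` F) \<le> Sup (j ` I)"
    if "lattice_filter F" "lattice_ideal I" "Inf (j ` F) \<le> u" "v \<le> Sup (j ` I)" for F I
    \<comment> \<open>Passes from an ideal given as a set to the corresponding element of
      \<open>idl\<close>.\<close>
    using H[rule_format, of F "Abs_idl I"] that by (simp add: idl_set_Abs_idl)
  then show "u \<le> v"
    using assms unfolding lattice_canonical_extension_def by blast
qed

text \<open>One direction is compactness; for the other, a common element \<open>a\<close> gives
  \<open>j a\<close> between the meet and the join.\<close>

lemma lattice_extension_le_iff:
  assumes "lattice_canonical_extension j" and "lattice_filter F" and "lattice_ideal I"
  shows "Inf (j ` F) \<le> Sup (j ` I) \<longleftrightarrow> F \<inter> I \<noteq> {}"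
proof
  assume "Inf (j ` F) \<le> Sup (j ` I)"
  then show "F \<inter> I \<noteq> {}"
    using assms unfolding lattice_canonical_extension_def by blast
next
  assume "F \<inter> I \<noteq> {}"
  then obtain a where "a \<in> F" "a \<in> I" by blast
  then have "Inf (j ` F) \<le> j a" "j a \<le> Sup (j ` I)"
    by (auto intro: Inf_lower Sup_upper)
  then show "Inf (j ` F) \<le> Sup (j ` I)"
    by (rule order_trans)
qed

text \<open>Reindexing density by filters of the lattice is possible because every Scott-open filter
  has the form \<open>ideals_meeting F\<close>.\<close>

lemma frame_extension_dense_pair:
  fixes e :: "'a::{distrib_lattice, bounded_lattice} idl \<Rightarrow> 'c::complete_lattice"
  assumes "frame_canonical_extension e"
  shows "dense_pair {F. lattice_filter F} (\<lambda>F. Inf (e ` ideals_meeting F)) e"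
  unfolding dense_pair_def
proof (intro allI impI)
  fix u v
  assume H: "\<forall>F\<in>{F. lattice_filter F}. \<forall>I. Inf (e ` ideals_meeting F) \<le> u \<longrightarrow> v \<le> e I \<longrightarrow>
      Inf (e ` ideals_meeting F) \<le> e I"
  have "Inf (e ` \<kappa>) \<le> e I" if "scott_open_filter \<kappa>" "Inf (e ` \<kappa>) \<le> u" "v \<le> e I" for \<kappa> I
    using H that scott_open_filter_is_ideals_meeting[OF that(1)] by blast
  then show "u \<le> v"
    using assms unfolding frame_canonical_extension_def by blast
qed

lemma frame_extension_le_iff:
  assumes "frame_canonical_extension e" and "scott_open_filter \<kappa>"
  shows "Inf (e ` \<kappa>) \<le> e I \<longleftrightarrow> I \<in> \<kappa>"
  using assms unfolding frame_canonical_extension_def by (blast intro: Inf_lower)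

lemma bounded_lattice_embedding_mono:
  assumes "bounded_lattice_embedding j"
  shows "mono j"
  using assms unfolding bounded_lattice_embedding_def by (metis monoI le_iff_inf)

theorem proposition8p1:
  fixes j :: "'a::{distrib_lattice, bounded_lattice} \<Rightarrow> 'b::complete_lattice"
    and e :: "'a idl \<Rightarrow> 'c::complete_lattice"
  assumes "lattice_canonical_extension j"
    and "frame_canonical_extension e"
  shows "\<exists>\<phi> :: 'b \<Rightarrow> 'c. complete_lattice_iso \<phi> \<and> (\<forall>a. \<phi> (j a) = e (principal_idl a))"
proof -
  \<comment> \<open>Both inequalities say that \<open>F\<close> meets \<open>I\<close>.\<close>
  have "Inf (j ` F) \<le> Sup (j ` idl_set I) \<longleftrightarrow> Inf (e ` ideals_meeting F) \<le> e I"
    if "F \<in> {F. lattice_filter F}" for F I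
    using that lattice_extension_le_iff[OF assms(1)]
      frame_extension_le_iff[OF assms(2) scott_open_ideals_meeting]
    by (simp add: ideals_meeting_def)
  from dense_pair_iso[OF lattice_extension_dense_pair[OF assms(1)]
      frame_extension_dense_pair[OF assms(2)] this]
  obtain \<phi> where \<phi>: "complete_lattice_iso \<phi>" "\<And>I. \<phi> (Sup (j ` idl_set I)) = e I"
    by blast
  have "mono j"
    using assms(1) unfolding lattice_canonical_extension_def
    by (blast intro: bounded_lattice_embedding_mono)
  \<comment> \<open>The element \<open>a\<close> is the greatest of its principal ideal, so the open
    element of that ideal is \<open>j a\<close>, and the claim is the principal case of the property
    of \<phi>.\<close>
  then have "Sup (j ` idl_set (principal_idl a)) = j a" for a
    by (intro order.antisym[OF SUP_least SUP_upper]) (auto dest: monoD)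
  with \<phi> show ?thesis
    by metis
qed

end
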